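(* Let $x\in[-1,1]$, let $r,s$ be natural numbers, let $M\in[-1,1]$, and let $X=M\cdot T_{r\cdot s}(x)$, where $T_{r\cdot s}(x)\neq 0$. Let $r'$ be any natural number such that $T_{r'}(x)=T_r(x)$. Then $T_{r'\cdot s}(x)=T_{r'}(T_s(x))=T_{r\cdot s}(x)$, and consequently $M=\dfrac{X}{T_{r'}(T_s(x))}$. (That is, given the public key $(x,T_s(x))$ and the ciphertext $(T_r(x),X)$, any such $r'$ allows the plaintext $M$ to be recovered.)
   Context: For $n\in\mathbb{N}$ (with $0\in\mathbb{N}$), the Chebyshev polynomial $T_n:[-1,1]\to[-1,1]$ is defined recursively by $T_0(x)=1$, $T_1(x)=x$, $T_n(x)=2x\,T_{n-1}(x)-T_{n-2}(x)$ for $n\ge 2$; equivalently $T_n(x)=\cos(n\arccos(x))$, where $\arccos:[-1,1]\to[0,\pi]$. In the cryptosystem considered, Alice's private key is a large integer $s$, her public key is $(x,T_s(x))$ with $x\in[-1,1]$, and a message $M\in[-1,1]$ is encrypted by choosing a large integer $r$ and sending $(T_r(x),\,M\cdot T_r(T_s(x)))$. *)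

theory Defs
  imports "HOL-Analysis.Analysis"
begin

(* The recursion defines T_n on all of the reals; the Chebyshev maps of the
   paper are the restrictions to [-1,1], which cheb_T_maps_to shows to be
   self-maps of that interval. *)
fun cheb_T :: "nat \<Rightarrow> real \<Rightarrow> real" where
  "cheb_T 0 x = 1"
| "cheb_T (Suc 0) x = x"
| "cheb_T (Suc (Suc n)) x = 2 * x * cheb_T (Suc n) x - cheb_T n x"

lemma cheb_T_arccos:
  assumes "x \<in> {-1..1}"
  shows "cheb_T n x = cos (real n * arccos x)"
  using assms
proof (induction n x rule: cheb_T.induct)
  case (3 n x)
  let ?t = "arccos x"
  have x: "cos ?t = x" using 3 by simp
  have "cos (real (Suc (Suc n)) * ?t) + cos (real n * ?t)
      = 2 * cos ?t * cos (real (Suc n) * ?t)"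
    using cos_add[of "real (Suc n) * ?t" ?t] cos_diff[of "real (Suc n) * ?t" ?t]
    by (simp add: algebra_simps)
  then show ?case using 3 x by simp
qed simp_all

lemma cheb_T_maps_to:
  assumes "x \<in> {-1..1}"
  shows "cheb_T n x \<in> {-1..1}"
  using assms by (simp add: cheb_T_arccos)

end

theory Submission
  imports Defs
begin

(* The semigroup property T_{mn} = T_m o T_n makes T_{r's}(x) depend on r' only
   through T_{r'}(x), because T_{r's}(x) = T_s(T_{r'}(x)). *)

text \<open>On \<open>cos t\<close>, the n-th polynomial multiplies the angle by n
  (\<open>cheb_T_cos\<close>), so composition multiplies indices (\<open>cheb_T_mult\<close>) and is
  commutative on [-1,1].\<close>

lemma cheb_T_cos: "cheb_T n (cos t) = cos (real n * t)"
proof (induction n "cos t" rule: cheb_T.induct)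
  case (3 n)
  have "cos (real (Suc (Suc n)) * t) + cos (real n * t) = 2 * cos t * cos (real (Suc n) * t)"
    using cos_add[of "real (Suc n) * t" t] cos_diff[of "real (Suc n) * t" t]
    by (simp add: algebra_simps)
  with 3 show ?case by simp
qed simp_all

lemma cheb_T_mult:
  assumes "x \<in> {-1..1}"
  shows "cheb_T (m * n) x = cheb_T m (cheb_T n x)"
  \<comment> \<open>The angle \<open>n * arccos x\<close> may leave [0, pi], so the outer polynomial
    needs \<open>cheb_T_cos\<close>, valid for every real angle.\<close>
  using assms by (simp add: cheb_T_arccos[of x] cheb_T_cos mult.assoc)

theorem mainTheorem1:
  fixes x M X :: real and r s r' :: nat
  assumes "x \<in> {-1..1}"
    and "M \<in> {-1..1}"
    and "X = M * cheb_T (r * s) x"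
    and "cheb_T (r * s) x \<noteq> 0"
    and "cheb_T r' x = cheb_T r x"
  shows "cheb_T (r' * s) x = cheb_T r' (cheb_T s x)
    \<and> cheb_T r' (cheb_T s x) = cheb_T (r * s) x
    \<and> M = X / cheb_T r' (cheb_T s x)"
proof -
  have r's: "cheb_T (r' * s) x = cheb_T r' (cheb_T s x)"
    using assms(1) by (rule cheb_T_mult)
  \<comment> \<open>Taking \<open>s\<close> as the outer index puts \<open>cheb_T r' x\<close>
    inside, where it can be replaced by \<open>cheb_T r x\<close>.\<close>
  have "cheb_T (r' * s) x = cheb_T (r * s) x"
    using assms(5) cheb_T_mult[OF assms(1), of s r'] cheb_T_mult[OF assms(1), of s r]
    by (simp add: mult.commute)
  with r's assms(3,4) show ?thesis by simp
qed

end
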